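(* Let $q$ and $q+2$ both be prime powers. The commutative association scheme on $X=\mathbb{F}_{q+2}\times\mathbb{F}_q\times\mathbb{F}_q$ with adjacency matrices $A_0=I_{(q+2)q^2}$, $A_1=(J_{q+2}-I_{q+2})\otimes I_{q^2}$, $A_2=I_{q+2}\otimes(J_{q^2}-I_{q^2})$, $A_{3,\beta}=N_\beta-A_1$ ($\beta\in\mathbb{F}_{q+2}^*$), with $N_\beta$ as in the context, is self-dual.
   Context: $I_n,J_n$ are the identity and all-ones matrices of order $n$, $\mathbb{F}_r^*=\mathbb{F}_r\setminus\{0\}$, $\otimes$ is the Kronecker product. Let $x,y$ be two new symbols and fix a bijection $\varphi:\mathbb{F}_{q+2}\to\mathbb{F}_q\cup\{x,y\}$ with $\varphi(0)=x$. Matrices of order $(q+2)q^2$ have rows and columns indexed by $X$ (lexicographic order, compatible with the Kronecker products). For $\beta\in\mathbb{F}_{q+2}^*$, $N_\beta$ is the $(0,1)$-matrix whose $((b,a_1,a_2),(b',a_1',a_2'))$-entry is: with $c=\varphi(\beta(b'-b))$, the entry is $1$ if $c\in\mathbb{F}_q$ and $a_2'-a_2=c(a_1'-a_1)$, or if $c=y$ and $a_1=a_1'$; and $0$ otherwise. These matrices form a commutative association scheme. For a commutative association scheme with adjacency matrices $A_0,\dots,A_n$, the Bose–Mesner algebra (their linear span) has a basis of primitive idempotents $E_0=\frac{1}{|X|}J_{|X|},E_1,\dots,E_n$; the first and second eigenmatrices $P=(p_{ij})$, $Q=(q_{ij})$ are defined by $A_j=\sum_i p_{ij}E_i$ and $E_j=\frac{1}{|X|}\sum_i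 q_{ij}A_i$. The scheme is self-dual if $P=\overline{Q}$ (complex conjugate) for a suitable ordering of the adjacency matrices and of the primitive idempotents. *)

theory Defs
  imports "HOL-Analysis.Analysis" "HOL-Number_Theory.Prime_Powers"
begin

definition all_ones :: "complex ^ 'n ^ 'n" where
  "all_ones = (\<chi> i j. 1)"

definition mat_scale :: "complex \<Rightarrow> complex ^ 'n ^ 'n \<Rightarrow> complex ^ 'n ^ 'n"  (infixr \<open>*\<^sub>M\<close> 75) where
  "c *\<^sub>M M = map_matrix (\<lambda>x. c * x) M"

definition kronecker ::
    "complex ^ 'm ^ 'm \<Rightarrow> complex ^ 'n ^ 'n \<Rightarrow> complex ^ ('m \<times> 'n) ^ ('m \<times> 'n)"  (infixr \<open>\<otimes>\<^sub>M\<close> 80) where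
  "M \<otimes>\<^sub>M N = (\<chi> r s. M $ fst r $ fst s * N $ snd r $ snd s)"

text \<open>The adjacency matrices are a family \<open>A\<close> over a finite index set \<open>I\<close>.
  Together, the entries in {0, 1}, the sum and the non-vanishing condition say that the matrices
  are the adjacency matrices of a partition of \<open>X \<times> X\<close> into nonempty relations.\<close>

definition commutative_association_scheme :: "'i set \<Rightarrow> ('i \<Rightarrow> complex ^ 'x ^ 'x) \<Rightarrow> bool" where
  "commutative_association_scheme I A \<longleftrightarrow>
     finite I \<and>
     (\<forall>i\<in>I. A i \<noteq> 0 \<and> (\<forall>x y. A i $ x $ y \<in> {0, 1})) \<and>
     (\<exists>i\<in>I. A i = mat 1) \<and>
     (\<Sum>i\<in>I. A i) = all_ones \<and>
     (\<forall>i\<in>I. \<exists>j\<in>I. transpose (A i) = A j) \<and>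
     (\<exists>p :: 'i \<Rightarrow> 'i \<Rightarrow> 'i \<Rightarrow> nat. \<forall>i\<in>I. \<forall>j\<in>I. A i ** A j = (\<Sum>k\<in>I. of_nat (p i j k) *\<^sub>M A k)) \<and>
     (\<forall>i\<in>I. \<forall>j\<in>I. A i ** A j = A j ** A i)"

definition bose_mesner :: "'i set \<Rightarrow> ('i \<Rightarrow> complex ^ 'x ^ 'x) \<Rightarrow> (complex ^ 'x ^ 'x) set" where
  "bose_mesner I A = {(\<Sum>i\<in>I. c i *\<^sub>M A i) | c. True}"

definition primitive_idempotents :: "(complex ^ 'x ^ 'x) set \<Rightarrow> (complex ^ 'x ^ 'x) set" where
  "primitive_idempotents \<A> = {E \<in> \<A>. E \<noteq> 0 \<and> E ** E = E \<and>
     (\<forall>F\<in>\<A>. \<forall>G\<in>\<A>. F ** F = F \<and> G ** G = G \<and> F ** G = 0 \<and> G ** F = 0 \<and> E = F + G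
        \<longrightarrow> F = 0 \<or> G = 0)}"

definition first_eigenmatrix ::
    "nat \<Rightarrow> (nat \<Rightarrow> complex ^ 'x ^ 'x) \<Rightarrow> (nat \<Rightarrow> complex ^ 'x ^ 'x) \<Rightarrow> (nat \<Rightarrow> nat \<Rightarrow> complex) \<Rightarrow> bool" where
  "first_eigenmatrix n A E P \<longleftrightarrow> (\<forall>j\<le>n. A j = (\<Sum>i\<le>n. P i j *\<^sub>M E i))"

definition second_eigenmatrix ::
    "nat \<Rightarrow> (nat \<Rightarrow> complex ^ 'x ^ 'x) \<Rightarrow> (nat \<Rightarrow> complex ^ 'x ^ 'x) \<Rightarrow> (nat \<Rightarrow> nat \<Rightarrow> complex) \<Rightarrow> bool" where
  "second_eigenmatrix n A E Q \<longleftrightarrow>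
     (\<forall>j\<le>n. E j = (1 / of_nat CARD('x)) *\<^sub>M (\<Sum>i\<le>n. Q i j *\<^sub>M A i))"

text \<open>The maps \<open>\<sigma>\<close> and \<open>E\<close> are the orderings of the adjacency matrices and of the primitive
  idempotents; the identity matrix and the normalised all-ones matrix keep position 0.
  In a commutative association scheme both families are bases of the Bose-Mesner algebra, so
  \<open>P\<close> and \<open>Q\<close> are determined by the two orderings.\<close>

definition self_dual :: "'i set \<Rightarrow> ('i \<Rightarrow> complex ^ 'x ^ 'x) \<Rightarrow> bool" where
  "self_dual I A \<longleftrightarrow>
     (\<exists>(n :: nat) \<sigma> E P Q.
        bij_betw \<sigma> {..n} I \<and> A (\<sigma> 0) = mat 1 \<and>
        bij_betw E {..n} (primitive_idempotents (bose_mesner I A)) \<and>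
        E 0 = (1 / of_nat CARD('x)) *\<^sub>M all_ones \<and>
        first_eigenmatrix n (\<lambda>i. A (\<sigma> i)) E P \<and>
        second_eigenmatrix n (\<lambda>i. A (\<sigma> i)) E Q \<and>
        (\<forall>i\<le>n. \<forall>j\<le>n. P i j = cnj (Q i j)))"

text \<open>The field of order \<open>q\<close> is \<open>'k\<close>, the field of order \<open>q + 2\<close> is \<open>'f\<close>, and \<open>X\<close> is
  \<open>'f \<times> 'k \<times> 'k\<close>, which is \<open>'f \<times> ('k \<times> 'k)\<close> as needed for the Kronecker products.
  The type \<open>'k slope\<close> is the field of order \<open>q\<close> with the two new symbols \<open>x\<close> and \<open>y\<close> adjoined.\<close>

datatype 'k slope = Slope 'k | SymX | SymY

definition N_mat ::
    "('f :: {field, finite} \<Rightarrow> 'k :: {field, finite} slope) \<Rightarrow> 'f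
     \<Rightarrow> complex ^ ('f \<times> 'k \<times> 'k) ^ ('f \<times> 'k \<times> 'k)" where
  "N_mat \<phi> \<beta> = (\<chi> r s. case (r, s) of ((b, a1, a2), (b', a1', a2')) \<Rightarrow>
     (case \<phi> (\<beta> * (b' - b)) of
        Slope c \<Rightarrow> if a2' - a2 = c * (a1' - a1) then 1 else 0
      | SymY \<Rightarrow> if a1 = a1' then 1 else 0
      | SymX \<Rightarrow> 0))"

datatype 'f scheme_index = C0 | C1 | C2 | C3 'f

definition scheme_indices :: "'f :: {field, finite} scheme_index set" where
  "scheme_indices = {C0, C1, C2} \<union> {C3 \<beta> | \<beta>. \<beta> \<noteq> 0}"

fun adj_mat ::
    "('f :: {field, finite} \<Rightarrow> 'k :: {field, finite} slope) \<Rightarrow> 'f scheme_index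
     \<Rightarrow> complex ^ ('f \<times> 'k \<times> 'k) ^ ('f \<times> 'k \<times> 'k)" where
  "adj_mat \<phi> C0 = mat 1"
| "adj_mat \<phi> C1 = (all_ones - mat 1) \<otimes>\<^sub>M mat 1"
| "adj_mat \<phi> C2 = mat 1 \<otimes>\<^sub>M (all_ones - mat 1)"
| "adj_mat \<phi> (C3 \<beta>) = N_mat \<phi> \<beta> - (all_ones - mat 1) \<otimes>\<^sub>M mat 1"

end

theory Submission
  imports Defs
begin

text \<open>Let \<open>\<psi>\<close> be a nontrivial additive character of the field of order \<open>r = q + 2\<close>, and let
  \<open>D a\<close> be the projection of \<open>complex ^ 'f\<close> onto the line of the character \<open>\<psi> (a * _)\<close>.  For a
  slope \<open>s\<close> let \<open>R s\<close> be \<open>L / q - J / q\<^sup>2\<close>, where \<open>L\<close> is the incidence matrix of the parallel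
  class \<open>s\<close>, and let \<open>R SymX = J / q\<^sup>2\<close>.  The \<open>r\<^sup>2\<close> matrices \<open>D a \<otimes> R (\<phi> t)\<close> are orthogonal
  idempotents, and the sums over the classes
  \<open>{(0, 0)}\<close>, \<open>{(a, 0) | a \<noteq> 0}\<close>, \<open>{(0, t) | t \<noteq> 0}\<close>, \<open>{(a, t) | a t = 1 / \<beta>}\<close>
  are the primitive idempotents of the scheme.  With the index \<open>C3 \<beta>\<close> given to the last class,
  the second eigenmatrix on the \<open>C3\<close> block is \<open>q \<psi> (1 / (\<alpha> \<beta>)) + 1\<close>, and the first eigenmatrix is
  its complex conjugate.\<close>

section \<open>Additive characters\<close>

lemma of_int_mult_mem_additive_subgroup:
  fixes H :: "'a::ring_1 set"
  assumes zero: "0 \<in> H" and diff: "\<And>x y. x \<in> H \<Longrightarrow> y \<in> H \<Longrightarrow> x - y \<in> H" and x: "x \<in> H"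
  shows "of_int k * x \<in> H"
proof -
  have minus: "- y \<in> H" if "y \<in> H" for y using diff[OF zero that] by simp
  have nat: "of_nat n * x \<in> H" for n
  proof (induction n)
    case (Suc n)
    then show ?case using diff[OF Suc minus[OF x]] by (simp add: algebra_simps)
  qed (simp add: zero)
  show ?thesis
  proof (cases k rule: int_cases2)
    case (nonneg n)
    then show ?thesis using nat[of n] by simp
  next
    case (nonpos n)
    then show ?thesis using minus[OF nat[of n]] by simp
  qed
qed

text \<open>A maximal proper subgroup \<open>H\<close> has a cyclic quotient, generated by the class of any
  \<open>a \<notin> H\<close>.\<close>

lemma exists_nontrivial_additive_character:
  "\<exists>\<psi> :: 'a::{ring_1,finite} \<Rightarrow> complex.
     (\<forall>x y. \<psi> (x + y) = \<psi> x * \<psi> y) \<and> (\<forall>x. norm (\<psi> x) = 1) \<and> (\<exists>x. \<psi> x \<noteq> 1)"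
proof -
  define sg where "sg = (\<lambda>H :: 'a set. 0 \<in> H \<and> (\<forall>x\<in>H. \<forall>y\<in>H. x - y \<in> H))"
  define \<H> where "\<H> = {H. sg H \<and> H \<noteq> UNIV}"
  have "{0} \<noteq> (UNIV :: 'a set)" by (metis UNIV_I singletonD zero_neq_one)
  then have "{0} \<in> \<H>" by (simp add: \<H>_def sg_def)
  from finite_has_maximal2[OF finite this] obtain H where H\<H>: "H \<in> \<H>"
    and "\<forall>K\<in>\<H>. H \<subseteq> K \<longrightarrow> H = K"
    by metis
  then have maxH: "H = K" if "K \<in> \<H>" "H \<subseteq> K" for K using that by metis
  from H\<H> have H: "sg H" and ne: "H \<noteq> UNIV" by (auto simp: \<H>_def)
  have H0: "0 \<in> H" and Hd: "\<And>x y. x \<in> H \<Longrightarrow> y \<in> H \<Longrightarrow> x - y \<in> H"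
    using H by (auto simp: sg_def)
  have Ha: "x + y \<in> H" if "x \<in> H" "y \<in> H" for x y
    using Hd[OF that(1) Hd[OF H0 that(2)]] by simp
  obtain a where a: "a \<notin> H" using ne by blast
  \<comment> \<open>\<open>K\<close> is the subgroup generated by \<open>H\<close> and
    \<open>a\<close>. Maximality of \<open>H\<close> makes it everything, so modulo \<open>H\<close>
    each \<open>x\<close> is a multiple \<open>k x\<close> of \<open>a\<close>.\<close>
  define K where "K = {x. \<exists>k. x - of_int k * a \<in> H}"
  have "sg K"
    unfolding sg_def
  proof (intro conjI ballI)
    show "0 \<in> K" unfolding K_def using H0 by (auto intro: exI[of _ 0])
  next
    fix x y assume "x \<in> K" "y \<in> K"
    then obtain k l where "x - of_int k * a \<in> H" "y - of_int l * a \<in> H" by (auto simp: K_def)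
    from Hd[OF this] have "(x - y) - of_int (k - l) * a \<in> H" by (simp add: algebra_simps)
    then show "x - y \<in> K" unfolding K_def by blast
  qed
  moreover have "H \<subseteq> K" unfolding K_def by (auto intro: exI[of _ 0])
  moreover have "a \<in> K" unfolding K_def using H0 by (auto intro: exI[of _ 1])
  ultimately have "K = UNIV" using maxH[of K] a by (auto simp: \<H>_def)
  then have "\<forall>x. \<exists>k. x - of_int k * a \<in> H" by (auto simp: K_def)
  then obtain k where k: "\<And>x. x - of_int (k x) * a \<in> H" by metis
  have "\<exists>m>0. of_nat m * a \<in> H"
  proof -
    have "\<not> inj (\<lambda>n. of_nat n * a)"
      using finite_imageD[of "\<lambda>n::nat. of_nat n * a" UNIV] by auto
    then obtain i j :: nat where "i < j" "of_nat i * a = of_nat j * a"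
      by (metis (mono_tags, lifting) injI linorder_less_linear)
    then have "of_nat (j - i) * a = 0" by (simp add: of_nat_diff algebra_simps)
    with \<open>i < j\<close> H0 show ?thesis by (intro exI[of _ "j - i"]) auto
  qed
  then have ex: "\<exists>m. m > 0 \<and> of_nat m * a \<in> H" by blast
  \<comment> \<open>\<open>m\<close> is the order of \<open>a\<close> modulo \<open>H\<close>;
    division with remainder shows that only multiples of \<open>m\<close> carry \<open>a\<close>
    into \<open>H\<close>.\<close>
  define m where "m = (LEAST m. m > 0 \<and> of_nat m * a \<in> H)"
  have m: "m > 0" "of_nat m * a \<in> H" using LeastI_ex[OF ex] by (simp_all add: m_def)
  have least: "m \<le> n" if "n > 0" "of_nat n * a \<in> H" for n
    unfolding m_def using that by (intro Least_le) simp
  have dvd: "int m dvd l" if "of_int l * a \<in> H" for l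
  proof (rule ccontr)
    assume nd: "\<not> int m dvd l"
    have "of_int (l div int m) * (of_nat m * a) \<in> H"
      by (rule of_int_mult_mem_additive_subgroup[OF H0 Hd m(2)])
    from Hd[OF that this] have "of_int (l - l div int m * int m) * a \<in> H"
      by (simp add: left_diff_distrib mult.assoc)
    then have "of_int (l mod int m) * a \<in> H" by (simp add: minus_div_mult_eq_mod)
    moreover have "0 \<le> l mod int m" "l mod int m \<noteq> 0" "l mod int m < int m"
      using m(1) nd by (auto simp: dvd_eq_mod_eq_0)
    ultimately show False
      using least[of "nat (l mod int m)"] by (simp add: of_nat_nat nat_less_iff)
  qed
  have m2: "m \<ge> 2" using m a by (cases "m = 1") auto
  define \<omega> where "\<omega> = cis (2 * pi / real m)"
  have \<omega>m: "\<omega> ^ m = 1" using m(1) by (simp add: \<omega>_def Complex.DeMoivre)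
  have \<omega>0: "\<omega> \<noteq> 0" and \<omega>n: "norm \<omega> = 1" by (auto simp: \<omega>_def)
  have \<omega>1: "\<omega> \<noteq> 1"
  proof
    assume "\<omega> = 1"
    then have "cos (2 * pi / real m) = 1" by (simp add: \<omega>_def complex_eq_iff)
    then obtain n :: int where "2 * pi / real m = of_int n * 2 * pi"
      using cos_one_2pi_int[of "2 * pi / real m"] by auto
    then have "1 = real_of_int (n * int m)" using m(1) by (simp add: field_simps)
    then have "n * int m = 1" by linarith
    then have "int m dvd 1" by (metis dvd_triv_right)
    then show False using m2 by simp
  qed
  have powi_eq: "\<omega> powi i = \<omega> powi j" if d: "int m dvd i - j" for i j
  proof -
    from d obtain c where "i = j + int m * c" by (auto simp: dvd_def algebra_simps)
    then show ?thesis using \<omega>0 \<omega>m by (simp add: power_int_add power_int_mult)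
  qed
  \<comment> \<open>\<open>k x\<close> is determined only modulo \<open>m\<close>, and
    \<open>\<omega> ^ m = 1\<close> makes this ambiguity harmless: \<open>\<psi>\<close> is additive
    although \<open>k\<close> need not be.\<close>
  define \<psi> where "\<psi> = (\<lambda>x. \<omega> powi k x)"
  have "\<psi> (x + y) = \<psi> x * \<psi> y" for x y
  proof -
    have "(x - of_int (k x) * a) + (y - of_int (k y) * a) - (x + y - of_int (k (x + y)) * a) \<in> H"
      by (intro Hd Ha k)
    then have "of_int (k (x + y) - (k x + k y)) * a \<in> H" by (simp add: algebra_simps)
    from powi_eq[OF dvd[OF this]] show ?thesis using \<omega>0 by (simp add: \<psi>_def power_int_add)
  qed
  moreover have "norm (\<psi> x) = 1" for x
    by (simp add: \<psi>_def norm_power_int \<omega>n)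
  moreover have "\<psi> a \<noteq> 1"
  proof -
    have "0 - (a - of_int (k a) * a) \<in> H" by (intro Hd k H0)
    then have "of_int (k a - 1) * a \<in> H" by (simp add: algebra_simps)
    from powi_eq[OF dvd[OF this]] \<omega>1 show ?thesis by (simp add: \<psi>_def)
  qed
  ultimately show ?thesis by blast
qed

section \<open>Schemes given by orthogonal idempotents\<close>

lemma mat_scale_component [simp]: "(c *\<^sub>M M) $ i $ j = c * M $ i $ j"
  by (simp add: mat_scale_def map_matrix_def)

lemma mat_scale_sum: "c *\<^sub>M (\<Sum>i\<in>S. M i) = (\<Sum>i\<in>S. c *\<^sub>M M i)"
  by (simp add: vec_eq_iff sum_distrib_left)

lemma sum_matrix_mult: "(\<Sum>i\<in>S. M i) ** N = (\<Sum>i\<in>S. M i ** N)"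
  by (induction S rule: infinite_finite_induct)
    (simp_all add: matrix_matrix_mult_def vec_eq_iff distrib_right sum.distrib)

lemma matrix_mult_sum: "N ** (\<Sum>i\<in>S. M i) = (\<Sum>i\<in>S. N ** M i)"
  by (induction S rule: infinite_finite_induct)
    (simp_all add: matrix_matrix_mult_def vec_eq_iff distrib_left sum.distrib)

lemma mat_scale_mult: "(c *\<^sub>M M) ** (d *\<^sub>M N) = (c * d) *\<^sub>M (M ** N)"
  by (simp add: matrix_matrix_mult_def vec_eq_iff sum_distrib_left mult_ac)

lemma bose_mesner_subset:
  assumes "\<And>i. i \<in> I \<Longrightarrow> A i \<in> bose_mesner I B"
  shows "bose_mesner I A \<subseteq> bose_mesner I B"
proof
  fix F assume "F \<in> bose_mesner I A"
  then obtain c where F: "F = (\<Sum>i\<in>I. c i *\<^sub>M A i)" by (auto simp: bose_mesner_def)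
  have "\<forall>i. \<exists>d. i \<in> I \<longrightarrow> A i = (\<Sum>j\<in>I. d j *\<^sub>M B j)"
    using assms by (fastforce simp: bose_mesner_def)
  then obtain d where d: "\<And>i. i \<in> I \<Longrightarrow> A i = (\<Sum>j\<in>I. d i j *\<^sub>M B j)" by metis
  have "F = (\<Sum>i\<in>I. \<Sum>j\<in>I. (c i * d i j) *\<^sub>M B j)"
    unfolding F by (intro sum.cong refl) (simp add: d mat_scale_sum, simp add: vec_eq_iff mult_ac)
  also have "\<dots> = (\<Sum>j\<in>I. (\<Sum>i\<in>I. c i * d i j) *\<^sub>M B j)"
    by (subst sum.swap) (simp add: vec_eq_iff sum_distrib_right)
  finally show "F \<in> bose_mesner I B" by (auto simp: bose_mesner_def)
qed

locale orthogonal_idempotents =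
  fixes I :: "'i set" and E :: "'i \<Rightarrow> complex ^ 'x ^ 'x"
  assumes finite_I: "finite I"
    and E_mult: "\<And>i j. i \<in> I \<Longrightarrow> j \<in> I \<Longrightarrow> E i ** E j = (if i = j then E i else 0)"
begin

text \<open>Orthogonality kills the cross terms, so products in the span are coordinatewise;
  commutativity of the scheme comes from this.\<close>

lemma comb_mult:
  "(\<Sum>i\<in>I. c i *\<^sub>M E i) ** (\<Sum>j\<in>I. d j *\<^sub>M E j) = (\<Sum>i\<in>I. (c i * d i) *\<^sub>M E i)"
proof -
  have "(\<Sum>i\<in>I. c i *\<^sub>M E i) ** (\<Sum>j\<in>I. d j *\<^sub>M E j)
      = (\<Sum>i\<in>I. \<Sum>j\<in>I. (c i * d j) *\<^sub>M (E i ** E j))"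
    by (simp only: sum_matrix_mult) (simp only: matrix_mult_sum mat_scale_mult)
  also have "\<dots> = (\<Sum>i\<in>I. \<Sum>j\<in>I. if i = j then (c i * d i) *\<^sub>M E i else 0)"
    by (intro sum.cong refl) (auto simp: E_mult vec_eq_iff)
  finally show ?thesis using finite_I by simp
qed

lemma comb_mult_single:
  assumes "j \<in> I"
  shows "(\<Sum>i\<in>I. c i *\<^sub>M E i) ** E j = c j *\<^sub>M E j"
proof -
  have E: "E j = (\<Sum>i\<in>I. of_bool (i = j) *\<^sub>M E i)"
    using assms finite_I by (simp add: vec_eq_iff)
  have "(\<Sum>i\<in>I. c i *\<^sub>M E i) ** E j = (\<Sum>i\<in>I. (c i * of_bool (i = j)) *\<^sub>M E i)"
    by (subst E, rule comb_mult)
  also have "\<dots> = (\<Sum>i\<in>I. if i = j then c j *\<^sub>M E j else 0)"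
    by (intro sum.cong refl) (auto simp: vec_eq_iff)
  also have "\<dots> = c j *\<^sub>M E j" using assms finite_I by simp
  finally show ?thesis .
qed

text \<open>Idempotents of the span have coordinates 0 and 1. With two coordinates equal to 1 they
  split; with only one, both parts of a splitting are multiples of the same \<open>E i\<close>, and
  the product of the two factors vanishes.\<close>

lemma primitive_idempotents_eq:
  assumes nz: "\<And>i. i \<in> I \<Longrightarrow> E i \<noteq> 0"
  shows "primitive_idempotents (bose_mesner I E) = E ` I"
proof -
  have mem: "(\<Sum>i\<in>I. c i *\<^sub>M E i) \<in> bose_mesner I E" for c by (auto simp: bose_mesner_def)
  have E_mem: "E i \<in> bose_mesner I E" if "i \<in> I" for i
  proof -
    have "E i = (\<Sum>j\<in>I. of_bool (j = i) *\<^sub>M E j)"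
      using that finite_I by (simp add: vec_eq_iff)
    then show ?thesis using mem by metis
  qed
  have scale_cancel: "c = d" if i: "i \<in> I" and eq: "c *\<^sub>M E i = d *\<^sub>M E i" for c d i
  proof -
    obtain x y where "E i $ x $ y \<noteq> 0" using nz[OF i] by (auto simp: vec_eq_iff)
    moreover have "(c *\<^sub>M E i) $ x $ y = (d *\<^sub>M E i) $ x $ y" using eq by simp
    ultimately show ?thesis by simp
  qed
  have idem01: "c i * c i = c i"
    if i: "i \<in> I" and F: "F = (\<Sum>i\<in>I. c i *\<^sub>M E i)" "F ** F = F" for c i F
  proof -
    have "(c i * c i) *\<^sub>M E i = (F ** F) ** E i"
      by (simp add: F(1) comb_mult comb_mult_single i)
    also have "\<dots> = c i *\<^sub>M E i" using F by (simp add: comb_mult_single i)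
    finally show ?thesis by (rule scale_cancel[OF i])
  qed
  show ?thesis
  proof (intro equalityI subsetI)
    fix F assume F: "F \<in> primitive_idempotents (bose_mesner I E)"
    then obtain c where c: "F = (\<Sum>i\<in>I. c i *\<^sub>M E i)"
      by (auto simp: primitive_idempotents_def bose_mesner_def)
    have F0: "F \<noteq> 0" and FF: "F ** F = F"
      using F by (auto simp: primitive_idempotents_def)
    have "\<exists>i\<in>I. c i \<noteq> 0"
    proof (rule ccontr)
      assume "\<not> (\<exists>i\<in>I. c i \<noteq> 0)"
      then have "F = 0" by (simp add: c vec_eq_iff)
      then show False using F0 by simp
    qed
    then obtain i where i: "i \<in> I" "c i \<noteq> 0" by blast
    then have ci: "c i = 1" using idem01[OF i(1) c FF] by simp
    \<comment> \<open>What remains of \<open>F\<close> once its \<open>i\<close>-th coordinate is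
      removed.\<close>
    define G where "G = (\<Sum>j\<in>I. (c j * of_bool (j \<noteq> i)) *\<^sub>M E j)"
    have Ei: "E i = (\<Sum>j\<in>I. of_bool (j = i) *\<^sub>M E j)"
      using i finite_I by (simp add: vec_eq_iff)
    have sq: "c j * of_bool (j \<noteq> i) * (c j * of_bool (j \<noteq> i)) = c j * of_bool (j \<noteq> i)"
      if "j \<in> I" for j
      using idem01[OF that c FF] by auto
    have GG: "G ** G = G" unfolding G_def comb_mult by (intro sum.cong refl) (simp add: sq)
    have EG: "E i ** G = 0" "G ** E i = 0"
      by (subst Ei, unfold G_def comb_mult, auto simp: vec_eq_iff intro!: sum.neutral)+
    have "F = E i + G"
      unfolding c G_def by (subst Ei, unfold sum.distrib[symmetric], intro sum.cong refl)
        (auto simp: vec_eq_iff ci)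
    moreover have "E i ** E i = E i" using E_mult[OF i(1) i(1)] by simp
    moreover have "G \<in> bose_mesner I E" unfolding G_def by (rule mem)
    ultimately have "E i = 0 \<or> G = 0"
      using F GG EG E_mem[OF i(1)] unfolding primitive_idempotents_def by blast
    then have "G = 0" using nz i by blast
    then show "F \<in> E ` I" using \<open>F = E i + G\<close> i by simp
  next
    fix F assume "F \<in> E ` I"
    then obtain i where i: "i \<in> I" "F = E i" by blast
    have "G = 0 \<or> H = 0"
      if G: "G \<in> bose_mesner I E" "G ** G = G" and H: "H \<in> bose_mesner I E" "H ** H = H"
        and GH: "G ** H = 0" "H ** G = 0" and sum: "E i = G + H" for G H
    proof -
      obtain c d where c: "G = (\<Sum>i\<in>I. c i *\<^sub>M E i)" and d: "H = (\<Sum>i\<in>I. d i *\<^sub>M E i)"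
        using G H by (auto simp: bose_mesner_def)
      \<comment> \<open>The cross products vanish, so multiplying by the sum \<open>E i\<close>
        changes neither part.\<close>
      have "G = G ** E i" "H = H ** E i"
        using G H GH by (simp_all add: sum matrix_add_ldistrib)
      then have G': "G = c i *\<^sub>M E i" and H': "H = d i *\<^sub>M E i"
        using comb_mult_single[OF i(1)] c d by metis+
      have "(c i * d i) *\<^sub>M E i = 0 *\<^sub>M E i"
        using GH(1) E_mult[OF i(1) i(1)] by (subst (asm) G', subst (asm) H')
          (simp add: mat_scale_mult vec_eq_iff)
      then have "c i * d i = 0" by (rule scale_cancel[OF i(1)])
      then show ?thesis using G' H' by (auto simp: vec_eq_iff)
    qed
    then show "F \<in> primitive_idempotents (bose_mesner I E)"
      using i nz E_mem E_mult[OF i(1) i(1)] unfolding primitive_idempotents_def by auto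
  qed
qed

end

section \<open>Association schemes from a pair of eigenmatrices\<close>

locale scheme_eigenmatrices = orthogonal_idempotents I E
  for I :: "'i set" and E :: "'i \<Rightarrow> complex ^ 'x ^ 'x" +
  fixes A :: "'i \<Rightarrow> complex ^ 'x ^ 'x" and rel :: "'x \<Rightarrow> 'x \<Rightarrow> 'i" and i0 :: 'i
    and P Q :: "'i \<Rightarrow> 'i \<Rightarrow> complex"
  assumes i0: "i0 \<in> I" "A i0 = mat 1" "E i0 = (1 / of_nat CARD('x)) *\<^sub>M all_ones"
    and rel_mem: "\<And>x y. rel x y \<in> I"
    and rel_surj: "\<And>i. i \<in> I \<Longrightarrow> \<exists>x y. rel x y = i"
    and A_entry: "\<And>i x y. i \<in> I \<Longrightarrow> A i $ x $ y = of_bool (rel x y = i)"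
    and transpose_A: "\<And>i. i \<in> I \<Longrightarrow> \<exists>j\<in>I. transpose (A i) = A j"
    and A_eq: "\<And>j. j \<in> I \<Longrightarrow> A j = (\<Sum>i\<in>I. P i j *\<^sub>M E i)"
    and E_eq: "\<And>j. j \<in> I \<Longrightarrow> E j = (1 / of_nat CARD('x)) *\<^sub>M (\<Sum>i\<in>I. Q i j *\<^sub>M A i)"
    and mult_nonzero: "\<And>j. j \<in> I \<Longrightarrow> Q i0 j \<noteq> 0"
begin

lemma comb_A_entry: "(\<Sum>i\<in>I. c i *\<^sub>M A i) $ x $ y = c (rel x y)"
  using finite_I rel_mem by (simp add: A_entry)

text \<open>On the identity relation \<open>E j\<close> has the entry
  \<open>Q i0 j / CARD('x)\<close>, so \<open>Q i0 j\<close> is the trace, hence the rank, of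
  \<open>E j\<close>.\<close>

lemma E_nonzero: "j \<in> I \<Longrightarrow> E j \<noteq> 0"
proof
  assume j: "j \<in> I" "E j = 0"
  obtain x y where xy: "rel x y = i0" using rel_surj[OF i0(1)] by blast
  have "E j $ x $ y = 1 / of_nat CARD('x) * Q i0 j"
    by (subst E_eq[OF j(1)], subst mat_scale_component, subst comb_A_entry) (simp add: xy)
  then show False using j mult_nonzero[OF j(1)] by simp
qed

lemma bose_mesner_eq: "bose_mesner I A = bose_mesner I E"
proof (intro equalityI bose_mesner_subset)
  fix j assume j: "j \<in> I"
  show "A j \<in> bose_mesner I E" using A_eq[OF j] by (auto simp: bose_mesner_def)
  have "E j = (\<Sum>i\<in>I. (1 / of_nat CARD('x) * Q i j) *\<^sub>M A i)"
    by (subst E_eq[OF j]) (simp add: mat_scale_sum, simp add: vec_eq_iff)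
  then show "E j \<in> bose_mesner I A" by (auto simp: bose_mesner_def)
qed

text \<open>Products are computed in the idempotents, where they are coordinatewise, and carried
  back through \<open>bose_mesner_eq\<close>.\<close>

lemma commutative_association_scheme: "commutative_association_scheme I A"
  unfolding commutative_association_scheme_def
proof (intro conjI ballI allI)
  show "finite I" by (rule finite_I)
  show "\<exists>i\<in>I. A i = mat 1" using i0 by blast
  have "(\<Sum>i\<in>I. A i) $ x $ y = all_ones $ x $ y" for x y
    using finite_I rel_mem by (simp add: A_entry all_ones_def)
  then show "(\<Sum>i\<in>I. A i) = all_ones" by (simp add: vec_eq_iff)
  fix i assume i: "i \<in> I"
  show "A i \<noteq> 0"
  proof
    assume "A i = 0"
    then show False using rel_surj[OF i] A_entry[OF i] by (auto simp: vec_eq_iff)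
  qed
  show "A i $ x $ y \<in> {0, 1}" for x y by (simp add: A_entry[OF i])
  show "\<exists>j\<in>I. transpose (A i) = A j" by (rule transpose_A[OF i])
  fix j assume j: "j \<in> I"
  show "A i ** A j = A j ** A i"
    by (simp add: A_eq[OF i] A_eq[OF j] comb_mult mult.commute)
next
  have "\<exists>p. A i ** A j = (\<Sum>k\<in>I. of_nat (p k) *\<^sub>M A k)" if i: "i \<in> I" and j: "j \<in> I" for i j
  proof -
    have "A i ** A j \<in> bose_mesner I E"
      by (auto simp: A_eq[OF i] A_eq[OF j] comb_mult bose_mesner_def)
    then obtain c where c: "A i ** A j = (\<Sum>k\<in>I. c k *\<^sub>M A k)"
      unfolding bose_mesner_eq[symmetric] by (auto simp: bose_mesner_def)
    \<comment> \<open>The coefficient of \<open>A k\<close> is the entry of the product at any pair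
      in relation \<open>k\<close>, and this entry counts intermediate points
      \<open>z\<close>.\<close>
    have "\<exists>n::nat. c k = of_nat n" if "k \<in> I" for k
    proof -
      obtain x y where xy: "rel x y = k" using rel_surj[OF \<open>k \<in> I\<close>] by blast
      have "c k = (A i ** A j) $ x $ y" unfolding c comb_A_entry xy ..
      also have "\<dots> = of_nat (\<Sum>z\<in>UNIV. of_bool (rel x z = i) * of_bool (rel z y = j))"
        by (simp add: matrix_matrix_mult_def A_entry[OF i] A_entry[OF j])
      finally show ?thesis by blast
    qed
    then obtain p :: "'i \<Rightarrow> nat" where "\<And>k. k \<in> I \<Longrightarrow> c k = of_nat (p k)" by metis
    then have "A i ** A j = (\<Sum>k\<in>I. of_nat (p k) *\<^sub>M A k)" using c by simp
    then show ?thesis by blast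
  qed
  then show "\<exists>p. \<forall>i\<in>I. \<forall>j\<in>I. A i ** A j = (\<Sum>k\<in>I. of_nat (p i j k) *\<^sub>M A k)" by metis
qed

lemma self_dual:
  assumes PQ: "\<And>i j. i \<in> I \<Longrightarrow> j \<in> I \<Longrightarrow> P i j = cnj (Q i j)"
  shows "self_dual I A"
proof -
  obtain n where n: "card I = Suc n" using i0(1) finite_I by (metis card_Suc_Diff1)
  have "card (I - {i0}) = card {1..n}" using n i0(1) by simp
  then obtain h where h: "bij_betw h {1..n} (I - {i0})"
    using finite_I by (metis finite_atLeastAtMost finite_Diff finite_same_card_bij)
  \<comment> \<open>One enumeration orders both the matrices and the idempotents, so
    \<open>P\<close> and \<open>Q\<close> are reindexed alike; position 0 is reserved for
    \<open>i0\<close>.\<close>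
  define \<sigma> where "\<sigma> = (\<lambda>i. if i = 0 then i0 else h i)"
  have "bij_betw \<sigma> ({0} \<union> {1..n}) ({i0} \<union> (I - {i0}))"
  proof (rule bij_betw_combine)
    show "bij_betw \<sigma> {1..n} (I - {i0})" using h by (subst bij_betw_cong[of _ \<sigma> h]) (auto simp: \<sigma>_def)
  qed (auto simp: \<sigma>_def bij_betw_def)
  moreover have "{0} \<union> {1..n} = {..n}" by auto
  moreover have "{i0} \<union> (I - {i0}) = I" using i0 by auto
  ultimately have \<sigma>: "bij_betw \<sigma> {..n} I" by simp
  have \<sigma>_mem: "\<sigma> i \<in> I" if "i \<le> n" for i using bij_betwE[OF \<sigma>] that by auto
  have "inj_on E I"
  proof (rule inj_onI, rule ccontr)
    fix i j assume ij: "i \<in> I" "j \<in> I" "E i = E j" "i \<noteq> j"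
    then have "E i ** E i = 0" using E_mult[of i j] by simp
    then show False using E_mult[of i i] E_nonzero ij by simp
  qed
  then have "bij_betw E I (primitive_idempotents (bose_mesner I A))"
    by (simp add: bij_betw_def bose_mesner_eq primitive_idempotents_eq E_nonzero)
  then have E: "bij_betw (E \<circ> \<sigma>) {..n} (primitive_idempotents (bose_mesner I A))"
    using \<sigma> by (rule bij_betw_trans[rotated])
  have "first_eigenmatrix n (\<lambda>i. A (\<sigma> i)) (E \<circ> \<sigma>) (\<lambda>i j. P (\<sigma> i) (\<sigma> j))"
    unfolding first_eigenmatrix_def
    using sum.reindex_bij_betw[OF \<sigma>, of "\<lambda>i. P i j *\<^sub>M E i" for j] by (simp add: A_eq \<sigma>_mem)
  moreover have "second_eigenmatrix n (\<lambda>i. A (\<sigma> i)) (E \<circ> \<sigma>) (\<lambda>i j. Q (\<sigma> i) (\<sigma> j))"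
    unfolding second_eigenmatrix_def
    using sum.reindex_bij_betw[OF \<sigma>, of "\<lambda>i. Q i j *\<^sub>M A i" for j] by (simp add: E_eq \<sigma>_mem)
  ultimately show ?thesis
    unfolding self_dual_def using \<sigma> E i0 PQ \<sigma>_mem
    by (intro exI[of _ n] exI[of _ \<sigma>] exI[of _ "E \<circ> \<sigma>"] exI[of _ "\<lambda>i j. P (\<sigma> i) (\<sigma> j)"]
         exI[of _ "\<lambda>i j. Q (\<sigma> i) (\<sigma> j)"]) (auto simp: \<sigma>_def)
qed

end


section \<open>Lines in the affine plane\<close>

lemma sum_shift_UNIV: "(\<Sum>w\<in>UNIV. g (w - v)) = (\<Sum>w\<in>(UNIV :: 'a::{ab_group_add,finite} set). g w)"
  by (rule sum.reindex_bij_witness[of _ "\<lambda>w. w + v" "\<lambda>w. w - v"]) auto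

lemma sum_reflect_UNIV: "(\<Sum>w\<in>UNIV. g (v - w)) = (\<Sum>w\<in>(UNIV :: 'a::{ab_group_add,finite} set). g w)"
  by (rule sum.reindex_bij_witness[of _ "\<lambda>w. v - w" "\<lambda>w. v - w"]) auto

lemma kronecker_mult: "(M \<otimes>\<^sub>M N) ** (M' \<otimes>\<^sub>M N') = (M ** M') \<otimes>\<^sub>M (N ** N')"
  by (simp add: kronecker_def matrix_matrix_mult_def vec_eq_iff sum_product sum.cartesian_product
      UNIV_Times_UNIV[symmetric] case_prod_beta mult_ac del: UNIV_Times_UNIV)

text \<open>Here \<open>v\<close> is the difference of two points. \<open>SymX\<close> contains no
  vector, not even 0: it marks the diagonal blocks, where \<open>N_mat\<close> vanishes.\<close>

fun on_line :: "'k::field slope \<Rightarrow> 'k \<times> 'k \<Rightarrow> bool" where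
  "on_line (Slope c) v \<longleftrightarrow> snd v = c * fst v"
| "on_line SymY v \<longleftrightarrow> fst v = 0"
| "on_line SymX v \<longleftrightarrow> False"

text \<open>The value \<open>SymY\<close> at \<open>v = 0\<close> is a mere default; the slope
  matters only for nonzero vectors.\<close>

definition slope_of :: "'k::field \<times> 'k \<Rightarrow> 'k slope" where
  "slope_of v = (if fst v = 0 then SymY else Slope (snd v / fst v))"

lemma on_line_iff: "v \<noteq> 0 \<Longrightarrow> on_line s v \<longleftrightarrow> s = slope_of v"
  by (cases s; cases v) (auto simp: slope_of_def field_simps zero_prod_def)

lemma on_line_zero: "on_line s 0 \<longleftrightarrow> s \<noteq> SymX"
  by (cases s) auto

lemma slope_of_not_SymX: "slope_of v \<noteq> SymX"
  by (simp add: slope_of_def)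

lemma on_line_diff: "on_line s w \<Longrightarrow> on_line s (u - w) \<longleftrightarrow> on_line s u"
  by (cases s) (auto simp: algebra_simps)

lemma card_on_line:
  assumes "s \<noteq> SymX"
  shows "card {w :: 'k::{field,finite} \<times> 'k. on_line s w} = CARD('k)"
proof (cases s)
  case (Slope c)
  then have "{w. on_line s w} = range (\<lambda>x. (x, c * x))" by auto
  then show ?thesis by (simp add: card_image inj_on_def)
next
  case SymY
  then have "{w. on_line s w} = range (Pair 0)" by auto
  then show ?thesis by (simp add: card_image inj_on_def)
qed (use assms in simp)

text \<open>Two distinct directions span the plane, so \<open>u\<close> splits uniquely into a
  vector on each line.\<close>

lemma card_on_two_lines:
  fixes u :: "'k::{field,finite} \<times> 'k"
  assumes s: "s \<noteq> SymX" and t: "t \<noteq> SymX" and st: "s \<noteq> t"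
  shows "card {w. on_line s w \<and> on_line t (u - w)} = 1"
proof -
  obtain u1 u2 where u: "u = (u1, u2)" by (cases u)
  have "\<exists>w. {w. on_line s w \<and> on_line t (u - w)} = {w}"
  proof (cases s)
    case s: (Slope c)
    show ?thesis
    proof (cases t)
      case t: (Slope d)
      then have nz: "c - d \<noteq> 0" using s st by auto
      have *: "u2 - c * x = d * (u1 - x) \<longleftrightarrow> (c - d) * x = u2 - d * u1" for x
        by (auto simp: algebra_simps)
      \<comment> \<open>The abscissa where the line of slope \<open>c\<close> through 0 meets the
        line of slope \<open>d\<close> through \<open>u\<close>.\<close>
      define x0 where "x0 = (u2 - d * u1) / (c - d)"
      have eq: "u2 - c * x = d * (u1 - x) \<longleftrightarrow> x = x0" for x
        unfolding * x0_def using nz by (simp add: nonzero_eq_divide_eq mult.commute)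
      show ?thesis
        by (rule exI[of _ "(x0, c * x0)"]) (auto simp: s t u eq)
    next
      case SymY
      then show ?thesis using s u by (intro exI[of _ "(u1, c * u1)"]) auto
    qed (use assms in simp)
  next
    case s: SymY
    show ?thesis
    proof (cases t)
      case (Slope d)
      then show ?thesis using s u by (intro exI[of _ "(0, u2 - d * u1)"]) (auto simp: algebra_simps)
    qed (use assms s in simp_all)
  qed (use assms in simp)
  then show ?thesis by force
qed

text \<open>The entries of \<open>R s\<close> as a function of the difference of two points.
  Subtracting the constant removes the constant functions, common to all parallel classes;
  \<open>SymX\<close> receives them.\<close>

definition line_kernel :: "'k::{field,finite} slope \<Rightarrow> 'k \<times> 'k \<Rightarrow> complex" where
  "line_kernel s v = (if s = SymX then 1 / of_nat CARD('k) ^ 2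
     else of_bool (on_line s v) / of_nat CARD('k) - 1 / of_nat CARD('k) ^ 2)"

lemma sum_of_bool_card: "(\<Sum>w\<in>UNIV. of_bool (P w)) = (of_nat (card {w :: 'a::finite. P w}) :: complex)"
  using sum.inter_filter[of UNIV "\<lambda>_. 1::complex" P] by (simp add: of_bool_def)

text \<open>Convolving the indicators of two lines through 0 gives \<open>q\<close> times the line
  if they agree and the constant 1 otherwise.\<close>

lemma line_kernel_convolution:
  fixes s t :: "'k::{field,finite} slope"
  shows "(\<Sum>w\<in>UNIV. line_kernel s w * line_kernel t (u - w)) = (if s = t then line_kernel s u else 0)"
proof -
  define q where "q = (of_nat CARD('k) :: complex)"
  have q: "q \<noteq> 0" by (simp add: q_def)
  have N: "of_nat CARD('k \<times> 'k) = q ^ 2" by (simp add: q_def power2_eq_square)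
  define L :: "'k slope \<Rightarrow> 'k \<times> 'k \<Rightarrow> complex" where "L = (\<lambda>s w. of_bool (on_line s w))"
  have k: "line_kernel s w = (if s = SymX then 1 / q ^ 2 else L s w / q - 1 / q ^ 2)" for s w
    by (simp add: line_kernel_def L_def q_def)
  have L1: "(\<Sum>w\<in>UNIV. L s w) = q" if "s \<noteq> SymX" for s
    by (simp add: L_def sum_of_bool_card card_on_line[OF that] q_def)
  have L2: "(\<Sum>w\<in>UNIV. L s (u - w)) = q" if "s \<noteq> SymX" for s
    using sum_reflect_UNIV[of "L s" u] L1[OF that] by simp
  have LL: "(\<Sum>w\<in>UNIV. L s w * L t (u - w)) = (if s = t then q * L s u else 1)"
    if st: "s \<noteq> SymX" "t \<noteq> SymX"
  proof -
    have *: "L s w * L t (u - w) = of_bool (on_line s w \<and> on_line t (u - w))" for w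
      by (simp add: L_def)
    show ?thesis
    proof (cases "s = t")
      case True
      then have eq: "L s w * L t (u - w) = L s w * L s u" for w
        unfolding L_def by (cases "on_line s w") (auto simp: on_line_diff)
      show ?thesis using True L1[OF st(1)] unfolding eq by (simp add: sum_distrib_right[symmetric])
    next
      case False
      then show ?thesis
        unfolding * sum_of_bool_card card_on_two_lines[OF st False] by simp
    qed
  qed
  consider "s = SymX" "t = SymX" | "s = SymX" "t \<noteq> SymX" | "s \<noteq> SymX" "t = SymX"
    | "s \<noteq> SymX" "t \<noteq> SymX" by blast
  then show ?thesis
  proof cases
    case 1
    then show ?thesis using q N by (simp add: k power2_eq_square field_simps)
  next
    case 2
    have "(\<Sum>w\<in>UNIV. line_kernel s w * line_kernel t (u - w))
        = 1 / q ^ 2 * ((\<Sum>w\<in>UNIV. L t (u - w)) / q - of_nat CARD('k \<times> 'k) * (1 / q ^ 2))"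
      using 2 by (simp add: k sum_distrib_left[symmetric] sum_subtractf sum_divide_distrib[symmetric]
          del: card_prod)
    then show ?thesis using 2 q unfolding N L2[OF 2(2)] by simp
  next
    case 3
    have "(\<Sum>w\<in>UNIV. line_kernel s w * line_kernel t (u - w))
        = ((\<Sum>w\<in>UNIV. L s w) / q - of_nat CARD('k \<times> 'k) * (1 / q ^ 2)) * (1 / q ^ 2)"
      using 3 by (simp add: k sum_divide_distrib[symmetric] sum_subtractf del: card_prod)
    then show ?thesis using 3 q unfolding N L1[OF 3(1)] by simp
  next
    case 4
    \<comment> \<open>After summation the last three terms add up to \<open>- 1 / q ^ 2\<close>,
      which cancels the first one for distinct classes.\<close>
    have "(\<Sum>w\<in>UNIV. line_kernel s w * line_kernel t (u - w))
        = (\<Sum>w\<in>UNIV. L s w * L t (u - w) / q ^ 2 - L s w / q ^ 3 - L t (u - w) / q ^ 3 + 1 / q ^ 4)"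
      using 4 q by (intro sum.cong refl) (simp add: k field_simps power_numeral_reduce)
    also have "\<dots> = (\<Sum>w\<in>UNIV. L s w * L t (u - w)) / q ^ 2 - (\<Sum>w\<in>UNIV. L s w) / q ^ 3
        - (\<Sum>w\<in>UNIV. L t (u - w)) / q ^ 3 + of_nat CARD('k \<times> 'k) * (1 / q ^ 4)"
      by (simp add: sum.distrib sum_subtractf sum_divide_distrib del: card_prod)
    also have "\<dots> = (if s = t then line_kernel s u else 0)"
      using 4 q unfolding N LL[OF 4] L1[OF 4(1)] L2[OF 4(2)]
      by (simp add: k field_simps power_numeral_reduce)
    finally show ?thesis .
  qed
qed

definition line_proj :: "'k::{field,finite} slope \<Rightarrow> complex ^ ('k \<times> 'k) ^ ('k \<times> 'k)" where
  "line_proj s = (\<chi> v w. line_kernel s (w - v))"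

lemma line_proj_mult: "line_proj s ** line_proj t = (if s = t then line_proj s else 0)"
proof -
  have "(line_proj s ** line_proj t) $ v $ u = (if s = t then line_proj s else 0) $ v $ u" for u v
  proof -
    have "(line_proj s ** line_proj t) $ v $ u
        = (\<Sum>w\<in>UNIV. line_kernel s (w - v) * line_kernel t (u - v - (w - v)))"
      by (simp add: matrix_matrix_mult_def line_proj_def)
    also have "\<dots> = (if s = t then line_kernel s (u - v) else 0)"
      using sum_shift_UNIV[of "\<lambda>w. line_kernel s w * line_kernel t (u - v - w)" v]
        line_kernel_convolution[of s t "u - v"] by simp
    finally show ?thesis by (simp add: line_proj_def)
  qed
  then show ?thesis by (simp add: vec_eq_iff)
qed

section \<open>The eigenmatrices\<close>

text \<open>\<open>q\<close> and \<open>r\<close> are the field orders as complex numbers, so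
  eigenvalue computations become polynomial identities modulo \<open>r = q + 2\<close>.\<close>

locale slope_scheme =
  fixes \<phi> :: "'f::{field,finite} \<Rightarrow> 'k::{field,finite} slope" and \<psi> :: "'f \<Rightarrow> complex"
    and q r :: complex
  assumes bij_\<phi>: "bij \<phi>" and \<phi>_0: "\<phi> 0 = SymX" and r_eq: "r = q + 2"
    and card_k [simp]: "of_nat CARD('k) = q" and card_f [simp]: "of_nat CARD('f) = r"
    and \<psi>_add: "\<And>x y. \<psi> (x + y) = \<psi> x * \<psi> y"
    and \<psi>_norm: "\<And>x. norm (\<psi> x) = 1"
    and \<psi>_nontrivial: "\<exists>x. \<psi> x \<noteq> 1"
begin

lemma q_nonzero [simp]: "q \<noteq> 0"
  unfolding card_k[symmetric] by (simp del: card_k)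

lemma cnj_q [simp]: "cnj q = q"
  unfolding card_k[symmetric] by (simp del: card_k)

lemma r_nonzero [simp]: "r \<noteq> 0"
  unfolding card_f[symmetric] by (simp del: card_f)

lemma \<phi>_eq_SymX: "\<phi> t = SymX \<longleftrightarrow> t = 0"
  using bij_\<phi> \<phi>_0 by (metis bij_pointE)

lemma \<psi>_nonzero: "\<psi> x \<noteq> 0"
  using \<psi>_norm[of x] by auto

lemma \<psi>_0: "\<psi> 0 = 1"
  using \<psi>_add[of 0 0] \<psi>_nonzero[of 0] by simp

lemma cnj_\<psi>: "cnj (\<psi> x) = \<psi> (- x)"
proof -
  have "\<psi> x * \<psi> (- x) = \<psi> x * cnj (\<psi> x)"
    using \<psi>_add[of x "- x"] \<psi>_norm[of x] by (simp add: \<psi>_0 complex_norm_square[symmetric])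
  then show ?thesis using \<psi>_nonzero[of x] by simp
qed

text \<open>For \<open>d \<noteq> 0\<close>, shifting \<open>a\<close> by \<open>c / d\<close>
  multiplies the sum by \<open>\<psi> c\<close>, and \<open>c\<close> can be chosen with
  \<open>\<psi> c \<noteq> 1\<close>.\<close>

lemma sum_\<psi>: "(\<Sum>a\<in>UNIV. \<psi> (a * d)) = r * of_bool (d = 0)"
proof (cases "d = 0")
  case True
  then show ?thesis by (simp add: \<psi>_0)
next
  case False
  obtain c where c: "\<psi> c \<noteq> 1" using \<psi>_nontrivial by blast
  have "(\<Sum>a\<in>UNIV. \<psi> ((a - (- (c / d))) * d)) = (\<Sum>a\<in>UNIV. \<psi> (a * d))"
    by (rule sum_shift_UNIV)
  moreover have "\<psi> ((a - (- (c / d))) * d) = \<psi> c * \<psi> (a * d)" for a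
    using False by (simp add: \<psi>_add[symmetric] algebra_simps)
  ultimately have "(1 - \<psi> c) * (\<Sum>a\<in>UNIV. \<psi> (a * d)) = 0"
    by (simp add: sum_distrib_left[symmetric] algebra_simps)
  then show ?thesis using c False by simp
qed

text \<open>Since \<open>1 / 0 = 0\<close>, inversion permutes the whole field, 0 included.\<close>

lemma sum_\<psi>_divide: "(\<Sum>t\<in>UNIV. \<psi> (d / t)) = r * of_bool (d = 0)"
proof -
  have "(\<Sum>t\<in>UNIV. \<psi> (d / t)) = (\<Sum>a\<in>UNIV. \<psi> (a * d))"
    by (rule sum.reindex_bij_witness[of _ inverse inverse]) (auto simp: field_simps)
  then show ?thesis by (simp add: sum_\<psi>)
qed

section \<open>Projections for a character and a parallel class\<close>

definition char_proj where
  "char_proj a = (\<chi> b b'. \<psi> (a * (b' - b)) / r)"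

lemma char_proj_mult: "char_proj a ** char_proj a' = (if a = a' then char_proj a else 0)"
proof -
  have "(char_proj a ** char_proj a') $ b $ b' = (if a = a' then char_proj a else 0) $ b $ b'" for b b'
  proof -
    have *: "\<psi> (a * (c - b)) / r * (\<psi> (a' * (b' - c)) / r)
        = \<psi> (c * (a - a')) * (\<psi> (a' * b' - a * b) / r ^ 2)" for c
      by (simp add: \<psi>_add[symmetric] power2_eq_square algebra_simps)
    have "(char_proj a ** char_proj a') $ b $ b'
        = r * of_bool (a - a' = 0) * (\<psi> (a' * b' - a * b) / r ^ 2)"
      unfolding matrix_matrix_mult_def char_proj_def vec_lambda_beta *
        sum_distrib_right[symmetric] sum_\<psi> ..
    then show ?thesis by (simp add: char_proj_def power2_eq_square algebra_simps)
  qed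
  then show ?thesis by (simp add: vec_eq_iff)
qed

definition W where
  "W p = char_proj (fst p) \<otimes>\<^sub>M line_proj (\<phi> (snd p))"

lemma W_mult: "W p ** W p' = (if p = p' then W p else 0)"
proof -
  have "\<phi> (snd p) = \<phi> (snd p') \<longleftrightarrow> snd p = snd p'"
    using bij_\<phi> by (auto simp: bij_def inj_def)
  then show ?thesis
    unfolding W_def kronecker_mult char_proj_mult line_proj_mult
    by (auto simp: kronecker_def vec_eq_iff prod_eq_iff)
qed

text \<open>This is \<open>q ^ 2 * line_kernel (\<phi> t) v\<close> in a single formula: at
  \<open>t = 0\<close> the line is empty and the last term turns -1 into 1.\<close>

definition kern :: "'f \<Rightarrow> 'k \<times> 'k \<Rightarrow> complex" where
  "kern t v = q * of_bool (on_line (\<phi> t) v) - 1 + 2 * of_bool (t = 0)"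

lemma W_entry:
  "r * q ^ 2 * W (a, t) $ x $ y = \<psi> (a * (fst y - fst x)) * kern t (snd y - snd x)"
  by (simp add: W_def kronecker_def char_proj_def line_proj_def line_kernel_def kern_def \<phi>_eq_SymX
      \<phi>_0 field_simps power2_eq_square)

text \<open>Relations are indexed by a difference \<open>(d, v)\<close>, idempotents by a pair \<open>(a, t)\<close>
  of a character of the first factor and a parallel class.\<close>

definition dir :: "'k \<times> 'k \<Rightarrow> 'f" where
  "dir v = inv \<phi> (slope_of v)"

text \<open>For nonzero \<open>d\<close> and \<open>v\<close>, \<open>N_mat \<phi> \<beta>\<close>
  has entry 1 iff \<open>\<phi> (\<beta> * d)\<close> is the slope of \<open>v\<close>, that is,
  \<open>\<beta> = dir v / d\<close>.\<close>

definition rel :: "'f \<Rightarrow> 'k \<times> 'k \<Rightarrow> 'f scheme_index" where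
  "rel d v = (if v = 0 then if d = 0 then C0 else C1 else if d = 0 then C2 else C3 (dir v / d))"

definition cls :: "'f \<times> 'f \<Rightarrow> 'f scheme_index" where
  "cls p = (if snd p = 0 then if fst p = 0 then C0 else C1
     else if fst p = 0 then C2 else C3 (1 / (fst p * snd p)))"

definition Idem where
  "Idem j = (\<Sum>p | cls p = j. W p)"

text \<open>\<open>Q i j\<close> is the value of \<open>r * q ^ 2 * Idem j\<close> on relation
  \<open>i\<close>. The row of \<open>C0\<close> gives the ranks: \<open>C1\<close> collects
  \<open>q + 1\<close> pieces of rank 1, \<open>C2\<close> and each \<open>C3 \<alpha>\<close> with
  \<open>\<alpha> \<noteq> 0\<close> collect \<open>q + 1\<close> pieces of rank
  \<open>q - 1\<close>.\<close>

fun Q :: "'f scheme_index \<Rightarrow> 'f scheme_index \<Rightarrow> complex" where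
  "Q i C0 = 1"
| "Q i C1 = (if i = C0 \<or> i = C2 then q + 1 else - 1)"
| "Q i C2 = (if i = C0 \<or> i = C1 then q ^ 2 - 1 else - 1)"
| "Q C0 (C3 \<alpha>) = q ^ 2 - 1"
| "Q C1 (C3 \<alpha>) = 1 - q"
| "Q C2 (C3 \<alpha>) = - 1"
| "Q (C3 \<beta>) (C3 \<alpha>) = q * \<psi> (1 / (\<alpha> * \<beta>)) + 1"

lemma dir_nonzero: "dir v \<noteq> 0"
  unfolding dir_def by (metis \<phi>_0 bij_\<phi> bij_inv_eq_iff slope_of_not_SymX)

lemma on_line_\<phi>: "on_line (\<phi> t) v \<longleftrightarrow> (if v = 0 then t \<noteq> 0 else t = dir v)"
  using bij_\<phi> by (auto simp: on_line_zero on_line_iff \<phi>_eq_SymX dir_def bij_inv_eq_iff)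

lemma dir_uminus: "dir (- v) = dir v"
  by (simp add: dir_def slope_of_def)

section \<open>Relations and adjacency matrices\<close>

lemma finite_scheme_indices: "finite (scheme_indices :: 'f scheme_index set)"
  by (simp add: scheme_indices_def)

lemma scheme_indices_cases:
  assumes "j \<in> scheme_indices"
  obtains "j = C0" | "j = C1" | "j = C2" | \<beta> where "j = C3 \<beta>" "\<beta> \<noteq> 0"
  using assms by (auto simp: scheme_indices_def)

lemma rel_mem: "rel d v \<in> scheme_indices"
  using dir_nonzero by (auto simp: rel_def scheme_indices_def)

lemma cls_mem: "cls p \<in> scheme_indices"
  by (auto simp: cls_def scheme_indices_def)

text \<open>The zero vector lies on every line, so \<open>N_mat \<phi> \<beta>\<close> is 1 at all
  pairs differing only in the first component; subtracting the matrix of \<open>C1\<close> removes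
  exactly these.\<close>

lemma adj_mat_entry:
  assumes "i \<in> scheme_indices"
  shows "adj_mat \<phi> i $ x $ y = of_bool (rel (fst y - fst x) (snd y - snd x) = i)"
proof -
  have N: "N_mat \<phi> \<beta> $ x $ y = of_bool (on_line (\<phi> (\<beta> * (fst y - fst x))) (snd y - snd x))" for \<beta>
    by (cases x; cases y) (auto simp: N_mat_def split: slope.split)
  from assms show ?thesis
  proof (cases rule: scheme_indices_cases)
    case (4 \<beta>)
    then show ?thesis
      by (auto simp: N on_line_\<phi> kronecker_def all_ones_def mat_def rel_def dir_nonzero field_simps)
  qed (auto simp: kronecker_def all_ones_def mat_def rel_def prod_eq_iff)
qed

lemma rel_surj:
  assumes "i \<in> scheme_indices"
  shows "\<exists>d v. rel d v = i"
  using assms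
proof (cases rule: scheme_indices_cases)
  case (4 \<beta>)
  have "rel (dir (1, 0) / \<beta>) (1, 0) = C3 \<beta>"
    using 4 dir_nonzero by (simp add: rel_def zero_prod_def)
  then show ?thesis using 4 by blast
next
  case 1
  have "rel 0 0 = C0" by (simp add: rel_def)
  then show ?thesis using 1 by blast
next
  case 2
  have "rel 1 0 = C1" by (simp add: rel_def)
  then show ?thesis using 2 by blast
next
  case 3
  have "rel 0 (1, 0) = C2" by (simp add: rel_def zero_prod_def)
  then show ?thesis using 3 by blast
qed

text \<open>Transposition negates both differences. As \<open>v\<close> and \<open>- v\<close> have
  the same slope, only the sign of \<open>\<beta>\<close> changes.\<close>

lemma transpose_adj_mat:
  assumes i: "i \<in> scheme_indices"
  shows "\<exists>j\<in>scheme_indices. transpose (adj_mat \<phi> i) = adj_mat \<phi> j"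
proof -
  define j where "j = (case i of C3 \<beta> \<Rightarrow> C3 (- \<beta>) | _ \<Rightarrow> i)"
  have j: "j \<in> scheme_indices"
    using i by (cases rule: scheme_indices_cases) (auto simp: j_def scheme_indices_def)
  have "rel (- d) (- v) = i \<longleftrightarrow> rel d v = j" for d v
    by (cases i) (auto simp: rel_def j_def dir_uminus)
  from this[of "fst y - fst x" "snd y - snd x" for x y] have "transpose (adj_mat \<phi> i) = adj_mat \<phi> j"
    by (simp add: vec_eq_iff transpose_def adj_mat_entry[OF i] adj_mat_entry[OF j])
  with j show ?thesis by blast
qed

section \<open>Idempotents and the second eigenmatrix\<close>

lemma Idem_mult: "Idem i ** Idem j = (if i = j then Idem i else 0)"
proof -
  have "Idem i ** Idem j = (\<Sum>p | cls p = i. \<Sum>p' | cls p' = j. if p = p' then W p else 0)"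
    by (simp only: Idem_def sum_matrix_mult) (simp only: matrix_mult_sum W_mult)
  also have "\<dots> = (\<Sum>p | cls p = i. if cls p = j then W p else 0)"
    by (intro sum.cong refl) (simp add: sum.delta')
  also have "\<dots> = (if i = j then Idem i else 0)" by (simp add: Idem_def)
  finally show ?thesis .
qed

text \<open>Each entry is a character sum over a class. \<open>C1\<close> reduces to
  \<open>sum_\<psi>\<close>, while \<open>C2\<close> and \<open>C3 \<beta>\<close> are instances of
  one sum over nonzero \<open>t\<close>.\<close>

lemma Idem_entry:
  assumes j: "j \<in> scheme_indices"
  shows "r * q ^ 2 * Idem j $ x $ y = Q (rel (fst y - fst x) (snd y - snd x)) j"
proof -
  define d where "d = fst y - fst x"
  define v where "v = snd y - snd x"
  have entry: "r * q ^ 2 * Idem j $ x $ y = (\<Sum>(a, t) | cls (a, t) = j. \<psi> (a * d) * kern t v)"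
    unfolding Idem_def sum_component sum_distrib_left d_def v_def
    by (intro sum.cong) (auto simp: W_entry)
  have sum1: "(\<Sum>t\<in>UNIV. f t) = f 0 + (\<Sum>t\<in>-{0}. f t)" for f :: "'f \<Rightarrow> complex"
    by (simp add: Compl_eq_Diff_UNIV sum.remove[of UNIV 0])
  \<comment> \<open>Used with \<open>c = 0\<close> for \<open>C2\<close> and
    \<open>c = d / \<beta>\<close> for \<open>C3 \<beta>\<close>. The sum is first extended to
    \<open>t = 0\<close>, whose term is 1, so that \<open>sum_\<psi>_divide\<close> applies.\<close>
  have G: "(\<Sum>t\<in>-{0}. \<psi> (c / t) * kern t v)
      = (if v = 0 then (q - 1) * (r * of_bool (c = 0) - 1)
         else q * \<psi> (c / dir v) - r * of_bool (c = 0) + 1)" for c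
  proof -
    have "(\<Sum>t\<in>UNIV. \<psi> (c / t) * kern t v)
        = (\<Sum>t\<in>UNIV. q * (\<psi> (c / t) * of_bool (on_line (\<phi> t) v)) - \<psi> (c / t)
             + 2 * (if t = 0 then 1 else 0))"
      by (intro sum.cong refl) (auto simp: kern_def algebra_simps \<psi>_0)
    also have "\<dots> = q * (\<Sum>t\<in>UNIV. \<psi> (c / t) * of_bool (on_line (\<phi> t) v)) - r * of_bool (c = 0) + 2"
      by (simp only: sum.distrib sum_subtractf sum_distrib_left[symmetric] sum_\<psi>_divide)
        (simp add: sum.delta)
    also have "(\<Sum>t\<in>UNIV. \<psi> (c / t) * of_bool (on_line (\<phi> t) v))
        = (if v = 0 then r * of_bool (c = 0) - 1 else \<psi> (c / dir v))"
    proof (cases "v = 0")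
      case True
      have "(\<Sum>t\<in>UNIV. \<psi> (c / t) * of_bool (on_line (\<phi> t) v)) = (\<Sum>t\<in>-{0}. \<psi> (c / t))"
        using sum1[of "\<lambda>t. \<psi> (c / t) * of_bool (on_line (\<phi> t) v)"] True by (simp add: on_line_\<phi>)
      then show ?thesis using sum1[of "\<lambda>t. \<psi> (c / t)"] True by (simp add: sum_\<psi>_divide \<psi>_0)
    next
      case False
      then have "(\<Sum>t\<in>UNIV. \<psi> (c / t) * of_bool (on_line (\<phi> t) v))
          = (\<Sum>t\<in>UNIV. if t = dir v then \<psi> (c / t) else 0)"
        by (intro sum.cong refl) (simp add: on_line_\<phi>)
      then show ?thesis using False by simp
    qed
    finally show ?thesis
      using sum1[of "\<lambda>t. \<psi> (c / t) * kern t v"] \<phi>_0 by (auto simp: kern_def \<psi>_0 algebra_simps)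
  qed
  have "(\<Sum>(a, t) | cls (a, t) = j. \<psi> (a * d) * kern t v) = Q (rel d v) j"
    using j
  proof (cases rule: scheme_indices_cases)
    case 1
    have "{(a, t). cls (a, t) = C0} = {(0, 0)}" by (auto simp: cls_def)
    then show ?thesis using 1 \<phi>_0 by (simp add: kern_def \<psi>_0)
  next
    case 2
    have "(\<Sum>(a, t) | cls (a, t) = C1. \<psi> (a * d) * kern t v) = (\<Sum>a\<in>-{0}. \<psi> (a * d) * kern 0 v)"
      by (rule sum.reindex_bij_witness[of _ "\<lambda>a. (a, 0)" fst]) (auto simp: cls_def split: if_splits)
    also have "\<dots> = (\<Sum>a\<in>-{0}. \<psi> (a * d))" by (simp add: kern_def \<phi>_0)
    also have "\<dots> = r * of_bool (d = 0) - 1"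
      using sum1[of "\<lambda>a. \<psi> (a * d)"] unfolding sum_\<psi> by (simp add: \<psi>_0 algebra_simps)
    finally show ?thesis using 2 by (simp add: rel_def r_eq)
  next
    case 3
    have "(\<Sum>(a, t) | cls (a, t) = C2. \<psi> (a * d) * kern t v) = (\<Sum>t\<in>-{0}. \<psi> (0 / t) * kern t v)"
      by (rule sum.reindex_bij_witness[of _ "\<lambda>t. (0, t)" snd])
        (auto simp: cls_def \<psi>_0 split: if_splits)
    also note G
    finally show ?thesis using 3
      by (auto simp: rel_def \<psi>_0 r_eq algebra_simps power2_eq_square)
  next
    case (4 \<beta>)
    \<comment> \<open>On this class \<open>a * t = 1 / \<beta>\<close>, so \<open>t\<close>
      determines \<open>a\<close>.\<close>
    have "(\<Sum>(a, t) | cls (a, t) = C3 \<beta>. \<psi> (a * d) * kern t v)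
        = (\<Sum>t\<in>-{0}. \<psi> (d / \<beta> / t) * kern t v)"
      by (rule sum.reindex_bij_witness[of _ "\<lambda>t. (1 / (\<beta> * t), t)" snd])
        (use 4 in \<open>auto simp: cls_def field_simps split: if_splits\<close>)
    also note G
    finally show ?thesis using 4 dir_nonzero[of v]
      by (auto simp: rel_def \<psi>_0 r_eq algebra_simps power2_eq_square)
  qed
  then show ?thesis unfolding entry d_def v_def .
qed

section \<open>Spectral decomposition and the first eigenmatrix\<close>

lemma sum_kern: "(\<Sum>t\<in>UNIV. kern t v) = q ^ 2 * of_bool (v = 0)"
proof -
  \<comment> \<open>Zero lies on all \<open>q + 1\<close> lines through the origin, any other vector
    on just one.\<close>
  have lines: "(\<Sum>t\<in>UNIV. of_bool (on_line (\<phi> t) v)) = (if v = 0 then q + 1 else 1 :: complex)"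
  proof (cases "v = 0")
    case True
    have "(\<Sum>t\<in>UNIV. of_bool (on_line (\<phi> t) v)) = (\<Sum>t\<in>(UNIV :: 'f set). 1 - (if t = 0 then 1 else 0 :: complex))"
      using True by (intro sum.cong refl) (simp add: on_line_\<phi>)
    then show ?thesis using True by (simp add: sum_subtractf r_eq)
  next
    case False
    have "(\<Sum>t\<in>UNIV. of_bool (on_line (\<phi> t) v)) = (\<Sum>t\<in>UNIV. if t = dir v then 1 else 0 :: complex)"
      using False by (intro sum.cong refl) (simp add: on_line_\<phi>)
    then show ?thesis using False by simp
  qed
  have kern: "(\<Sum>t\<in>UNIV. kern t v)
      = q * (\<Sum>t\<in>UNIV. of_bool (on_line (\<phi> t) v)) - r + 2 * (\<Sum>t\<in>(UNIV :: 'f set). if t = 0 then 1 else 0)"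
    unfolding kern_def sum.distrib sum_subtractf sum_distrib_left[symmetric]
    by (simp add: of_bool_def)
  \<comment> \<open>The constants cancel because \<open>r = q + 2\<close>; the outcome says that the
    projections of all slopes, \<open>SymX\<close> included, sum to the identity.\<close>
  show ?thesis unfolding kern lines by (simp add: r_eq power2_eq_square algebra_simps)
qed

text \<open>Indicators merge the cases of \<open>cls\<close> so that orthogonality of characters can
  be applied to sums over all \<open>a\<close>; for instance, \<open>a = 0\<close> and
  \<open>t \<noteq> 0\<close> give \<open>q - (r - 1) = - 1\<close>.\<close>

lemma cnj_Q_cls:
  assumes "j \<in> scheme_indices"
  shows "cnj (Q (cls (a, t)) j) = (case j of C0 \<Rightarrow> 1
     | C1 \<Rightarrow> r * of_bool (a = 0) - 1
     | C2 \<Rightarrow> q ^ 2 * of_bool (t = 0) - 1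
     | C3 \<beta> \<Rightarrow> if t = 0 then (q - 1) * (r * of_bool (a = 0) - 1)
         else q * \<psi> (a * (- t / \<beta>)) - (r * of_bool (a = 0) - 1))"
  using assms
  by (cases rule: scheme_indices_cases)
    (auto simp: cls_def r_eq cnj_\<psi> \<psi>_0 algebra_simps power2_eq_square)

text \<open>Up to the factor \<open>r * q ^ 2\<close>, this is an entry of the spectral
  decomposition of \<open>adj_mat \<phi> j\<close>, with \<open>cnj (Q (cls (a, t)) j)\<close> as
  eigenvalue on the image of \<open>W (a, t)\<close>.\<close>

lemma sum_eigenvalues:
  assumes "j \<in> scheme_indices"
  shows "(\<Sum>t\<in>UNIV. \<Sum>a\<in>UNIV. cnj (Q (cls (a, t)) j) * (\<psi> (a * d) * kern t v))
    = r * q ^ 2 * of_bool (rel d v = j)"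
  using assms
proof (cases rule: scheme_indices_cases)
  case 1
  have "(\<Sum>t\<in>UNIV. \<Sum>a\<in>UNIV. \<psi> (a * d) * kern t v) = r * of_bool (d = 0) * (q ^ 2 * of_bool (v = 0))"
    by (simp only: sum_distrib_right[symmetric] sum_distrib_left[symmetric] sum_\<psi> sum_kern)
  then show ?thesis using 1 by (simp add: rel_def)
next
  case 2
  have "(\<Sum>a\<in>UNIV. (r * of_bool (a = 0) - 1) * \<psi> (a * d)) = r - r * of_bool (d = 0)"
  proof -
    have "(\<Sum>a\<in>UNIV. (r * of_bool (a = 0) - 1) * \<psi> (a * d))
        = (\<Sum>a\<in>UNIV. (if a = 0 then r else 0) - \<psi> (a * d))"
      by (intro sum.cong refl) (simp add: \<psi>_0 algebra_simps)
    then show ?thesis by (simp add: sum_subtractf sum_\<psi>)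
  qed
  moreover have "(\<Sum>t\<in>UNIV. \<Sum>a\<in>UNIV. cnj (Q (cls (a, t)) j) * (\<psi> (a * d) * kern t v))
      = (\<Sum>t\<in>UNIV. (\<Sum>a\<in>UNIV. (r * of_bool (a = 0) - 1) * \<psi> (a * d)) * kern t v)"
    unfolding sum_distrib_right using 2 cnj_Q_cls[OF assms]
    by (intro sum.cong refl) (simp add: mult.assoc)
  ultimately have "(\<Sum>t\<in>UNIV. \<Sum>a\<in>UNIV. cnj (Q (cls (a, t)) j) * (\<psi> (a * d) * kern t v))
      = (r - r * of_bool (d = 0)) * (q ^ 2 * of_bool (v = 0))"
    by (simp only: sum_distrib_left[symmetric] sum_kern)
  then show ?thesis using 2 by (simp add: rel_def)
next
  case 3
  have "(\<Sum>t\<in>UNIV. (q ^ 2 * of_bool (t = 0) - 1) * kern t v) = q ^ 2 - q ^ 2 * of_bool (v = 0)"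
  proof -
    have "(\<Sum>t\<in>UNIV. (q ^ 2 * of_bool (t = 0) - 1) * kern t v)
        = (\<Sum>t\<in>UNIV. (if t = 0 then q ^ 2 else 0) - kern t v)"
      using \<phi>_0 by (intro sum.cong refl) (simp add: kern_def algebra_simps)
    then show ?thesis by (simp add: sum_subtractf sum_kern)
  qed
  moreover have "(\<Sum>t\<in>UNIV. \<Sum>a\<in>UNIV. cnj (Q (cls (a, t)) j) * (\<psi> (a * d) * kern t v))
      = (\<Sum>t\<in>UNIV. (\<Sum>a\<in>UNIV. \<psi> (a * d)) * ((q ^ 2 * of_bool (t = 0) - 1) * kern t v))"
    unfolding sum_distrib_right using 3 cnj_Q_cls[OF assms]
    by (intro sum.cong refl) (simp add: mult_ac)
  ultimately have "(\<Sum>t\<in>UNIV. \<Sum>a\<in>UNIV. cnj (Q (cls (a, t)) j) * (\<psi> (a * d) * kern t v))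
      = r * of_bool (d = 0) * (q ^ 2 - q ^ 2 * of_bool (v = 0))"
    by (simp only: sum_distrib_left[symmetric] sum_\<psi>)
  then show ?thesis using 3 by (simp add: rel_def)
next
  case (4 \<beta>)
  define D where "D = r * of_bool (d = 0)"
  have R: "(\<Sum>a\<in>UNIV. (r * of_bool (a = 0) - 1) * \<psi> (a * d)) = r - D"
  proof -
    have "(\<Sum>a\<in>UNIV. (r * of_bool (a = 0) - 1) * \<psi> (a * d))
        = (\<Sum>a\<in>UNIV. (if a = 0 then r else 0) - \<psi> (a * d))"
      by (intro sum.cong refl) (simp add: \<psi>_0 algebra_simps)
    then show ?thesis by (simp add: sum_subtractf sum_\<psi> D_def)
  qed
  \<comment> \<open>For \<open>t \<noteq> 0\<close> the eigenvalue shifts the character from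
    \<open>d\<close> to \<open>d - t / \<beta>\<close>, which concentrates the sum at
    \<open>t = \<beta> * d\<close>. The last summand corrects \<open>t = 0\<close>, where the
    eigenvalue has another form; its \<open>2 * q * D\<close> also compensates the first summand
    when \<open>d = 0\<close>.\<close>
  have inner: "(\<Sum>a\<in>UNIV. cnj (Q (cls (a, t)) j) * (\<psi> (a * d) * kern t v))
      = (if t = \<beta> * d then q * r * kern t v else 0) - (r - D) * kern t v
        + (if t = 0 then q * r - 2 * q * D else 0)" for t
  proof (cases "t = 0")
    case True
    have "(\<Sum>a\<in>UNIV. cnj (Q (cls (a, t)) j) * (\<psi> (a * d) * kern t v))
        = (q - 1) * (\<Sum>a\<in>UNIV. (r * of_bool (a = 0) - 1) * \<psi> (a * d))"
      unfolding sum_distrib_left using 4 True \<phi>_0 cnj_Q_cls[OF assms]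
      by (intro sum.cong refl) (simp add: kern_def)
    then show ?thesis using True 4 \<phi>_0 unfolding R by (auto simp: kern_def D_def algebra_simps)
  next
    case False
    have "(\<Sum>a\<in>UNIV. cnj (Q (cls (a, t)) j) * (\<psi> (a * d) * kern t v))
        = (\<Sum>a\<in>UNIV. q * kern t v * \<psi> (a * (d - t / \<beta>))
            - kern t v * ((r * of_bool (a = 0) - 1) * \<psi> (a * d)))"
    proof (intro sum.cong refl)
      fix a
      have \<psi>: "\<psi> (a * (d - t / \<beta>)) = \<psi> (a * (- t / \<beta>)) * \<psi> (a * d)"
        by (simp add: \<psi>_add[symmetric] algebra_simps)
      have eig: "cnj (Q (cls (a, t)) j) = q * \<psi> (a * (- t / \<beta>)) - (r * of_bool (a = 0) - 1)"
        using 4 False cnj_Q_cls[OF assms, of a t] by simp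
      show "cnj (Q (cls (a, t)) j) * (\<psi> (a * d) * kern t v) = q * kern t v * \<psi> (a * (d - t / \<beta>))
            - kern t v * ((r * of_bool (a = 0) - 1) * \<psi> (a * d))"
        unfolding \<psi> eig by (simp only: algebra_simps)
    qed
    also have "\<dots> = q * kern t v * (r * of_bool (d - t / \<beta> = 0)) - kern t v * (r - D)"
      unfolding sum_subtractf sum_distrib_left[symmetric] sum_\<psi> R ..
    also have "d - t / \<beta> = 0 \<longleftrightarrow> t = \<beta> * d" using 4 by (auto simp: field_simps)
    finally show ?thesis using False by (simp add: algebra_simps)
  qed
  \<comment> \<open>For \<open>d \<noteq> 0\<close> the term \<open>kern (\<beta> * d) v\<close>
    carries the entry of \<open>N_mat\<close>, and the term with \<open>v = 0\<close> subtracts that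
    of \<open>C1\<close>.\<close>
  have "(\<Sum>t\<in>UNIV. \<Sum>a\<in>UNIV. cnj (Q (cls (a, t)) j) * (\<psi> (a * d) * kern t v))
      = q * r * kern (\<beta> * d) v - (r - D) * (q ^ 2 * of_bool (v = 0)) + (q * r - 2 * q * D)"
    unfolding inner sum.distrib sum_subtractf sum_distrib_left[symmetric] sum_kern by simp
  also have "\<dots> = r * q ^ 2 * of_bool (rel d v = j)"
  proof (cases "d = 0")
    case True
    then show ?thesis using 4 \<phi>_0 by (simp add: D_def kern_def rel_def)
  next
    case False
    then show ?thesis using 4
      by (auto simp: D_def kern_def rel_def on_line_\<phi> field_simps power2_eq_square)
  qed
  finally show ?thesis .
qed

lemma adj_mat_eq:
  assumes j: "j \<in> scheme_indices"
  shows "adj_mat \<phi> j = (\<Sum>i\<in>scheme_indices. cnj (Q i j) *\<^sub>M Idem i)"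
proof -
  have "adj_mat \<phi> j $ x $ y = (\<Sum>i\<in>scheme_indices. cnj (Q i j) *\<^sub>M Idem i) $ x $ y" for x y
  proof -
    define d where "d = fst y - fst x"
    define v where "v = snd y - snd x"
    \<comment> \<open>Summing over classes and then over their members is summing over all pairs
      \<open>(a, t)\<close>.\<close>
    have "r * q ^ 2 * (\<Sum>i\<in>scheme_indices. cnj (Q i j) *\<^sub>M Idem i) $ x $ y
        = (\<Sum>i\<in>scheme_indices. \<Sum>p | p \<in> UNIV \<and> cls p = i. cnj (Q (cls p) j) * (r * q ^ 2 * W p $ x $ y))"
      unfolding sum_component sum_distrib_left mat_scale_component Idem_def
      by (intro sum.cong refl) (auto simp: mult_ac)
    also have "\<dots> = (\<Sum>p\<in>UNIV. cnj (Q (cls p) j) * (r * q ^ 2 * W p $ x $ y))"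
      by (rule sum.group) (auto simp: finite_scheme_indices cls_mem)
    also have "\<dots> = (\<Sum>a\<in>UNIV. \<Sum>t\<in>UNIV. cnj (Q (cls (a, t)) j) * (\<psi> (a * d) * kern t v))"
      unfolding sum.cartesian_product UNIV_Times_UNIV d_def v_def
      by (intro sum.cong refl) (auto simp: W_entry)
    also have "\<dots> = r * q ^ 2 * adj_mat \<phi> j $ x $ y"
      by (subst sum.swap) (simp add: sum_eigenvalues[OF j] adj_mat_entry[OF j] d_def v_def)
    finally show ?thesis by simp
  qed
  then show ?thesis by (simp add: vec_eq_iff)
qed

lemma Idem_eq:
  assumes j: "j \<in> scheme_indices"
  shows "Idem j = (1 / of_nat CARD('f \<times> 'k \<times> 'k)) *\<^sub>M (\<Sum>i\<in>scheme_indices. Q i j *\<^sub>M adj_mat \<phi> i)"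
proof -
  have "(\<Sum>i\<in>scheme_indices. Q i j *\<^sub>M adj_mat \<phi> i) $ x $ y = r * q ^ 2 * Idem j $ x $ y" for x y
    unfolding Idem_entry[OF j]
    using rel_mem finite_scheme_indices by (simp add: adj_mat_entry)
  then show ?thesis by (simp add: vec_eq_iff power2_eq_square)
qed

lemma one_less_q: "1 < CARD('k)"
  using card_mono[of UNIV "{0, 1 :: 'k}"] by simp

text \<open>The conjugate of \<open>Q\<close> is supplied as first eigenmatrix, so the hypothesis of
  \<open>self_dual\<close> becomes trivial; the content of self-duality lies in
  \<open>adj_mat_eq\<close> and \<open>Idem_eq\<close>.\<close>

sublocale scheme_eigenmatrices scheme_indices Idem "adj_mat \<phi>"
    "\<lambda>x y. rel (fst y - fst x) (snd y - snd x)" C0 "\<lambda>i j. cnj (Q i j)" Q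
proof
  fix i j :: "'f scheme_index"
  show "finite (scheme_indices :: 'f scheme_index set)" by (rule finite_scheme_indices)
  show "Idem i ** Idem j = (if i = j then Idem i else 0)" by (rule Idem_mult)
  show "C0 \<in> (scheme_indices :: 'f scheme_index set)" by (simp add: scheme_indices_def)
  show "adj_mat \<phi> C0 = mat 1" by simp
  have "Idem C0 $ x $ y = 1 / (r * q ^ 2)" for x y
    using Idem_entry[of C0 x y] by (simp add: scheme_indices_def field_simps)
  then show "Idem C0 = (1 / of_nat CARD('f \<times> 'k \<times> 'k)) *\<^sub>M all_ones"
    by (simp add: vec_eq_iff all_ones_def power2_eq_square)
  show "rel (fst y - fst x) (snd y - snd x) \<in> scheme_indices" for x y :: "'f \<times> 'k \<times> 'k"
    by (rule rel_mem)
  assume i: "i \<in> scheme_indices"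
  obtain d v where "rel d v = i" using rel_surj[OF i] by blast
  then have "rel (fst (d, v) - fst (0, 0)) (snd (d, v) - snd (0, 0)) = i" by (simp add: zero_prod_def[symmetric])
  then show "\<exists>x y. rel (fst y - fst x) (snd y - snd x) = i" by blast
  show "adj_mat \<phi> i $ x $ y = of_bool (rel (fst y - fst x) (snd y - snd x) = i)" for x y
    by (rule adj_mat_entry[OF i])
  show "\<exists>j\<in>scheme_indices. transpose (adj_mat \<phi> i) = adj_mat \<phi> j" by (rule transpose_adj_mat[OF i])
  show "adj_mat \<phi> i = (\<Sum>k\<in>scheme_indices. cnj (Q k i) *\<^sub>M Idem k)" by (rule adj_mat_eq[OF i])
  show "Idem i = (1 / of_nat CARD('f \<times> 'k \<times> 'k)) *\<^sub>M (\<Sum>k\<in>scheme_indices. Q k i *\<^sub>M adj_mat \<phi> k)"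
    by (rule Idem_eq[OF i])
  \<comment> \<open>The ranks are 1, \<open>q + 1\<close> and \<open>q ^ 2 - 1\<close>; the last is
    nonzero because a field has more than one element.\<close>
  have "q + 1 \<noteq> 0"
    using of_nat_neq_0[of "CARD('k)", where 'a = complex] by (simp add: add.commute)
  moreover have "q ^ 2 - 1 \<noteq> 0"
  proof -
    have "q ^ 2 = of_nat (CARD('k) ^ 2)" by simp
    moreover have "CARD('k) ^ 2 \<noteq> 1" using one_less_q by (simp add: power2_eq_square)
    ultimately show ?thesis by (metis eq_iff_diff_eq_0 of_nat_eq_1_iff)
  qed
  ultimately show "Q C0 i \<noteq> 0" by (cases i) auto
qed

end

theorem theorem3p4:
  fixes q :: nat
    and \<phi> :: "'f :: {field, finite} \<Rightarrow> 'k :: {field, finite} slope"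
  assumes "primepow q" and "primepow (q + 2)"
    and "CARD('k) = q" and "CARD('f) = q + 2"
    and "bij \<phi>" and "\<phi> 0 = SymX"
  shows "commutative_association_scheme scheme_indices (adj_mat \<phi>) \<and>
         self_dual scheme_indices (adj_mat \<phi>)"
proof -
  obtain \<psi> :: "'f \<Rightarrow> complex" where "\<And>x y. \<psi> (x + y) = \<psi> x * \<psi> y" "\<And>x. norm (\<psi> x) = 1"
    "\<exists>x. \<psi> x \<noteq> 1"
    using exists_nontrivial_additive_character by metis
  then interpret slope_scheme \<phi> \<psi> "of_nat q" "of_nat (q + 2)" using assms by unfold_locales auto
  show ?thesis using commutative_association_scheme self_dual by blast
qed

end
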